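(* Let $p$ be a prime, let $b\in p\uparrow$ and $g\in\mathbb{Z}^+$. Let $P,Q,X,Y$ be integers with $P>Q>0$ and $X,Y\ge b$, and suppose $Y\mid\binom{PX}{QX}$. For integers $h,k,l,w,x,y$ define $$L:=lY,\quad U:=PLX,\quad V:=4gwY,\quad W:=bw,\quad K:=QX+1+k(U^PV-2),$$ $$A:=U^Q(V+1),\quad B:=PX+1,\quad C:=B+(A-2)h,$$ $$D:=(A^2-4)C^2+4,\quad E:=C^2Dx,\quad F:=4(A^2-4)E^2+1,\quad G:=1+CDF-2(A+2)(A-2)^2E^2,$$ $$H:=C+BF+(2y-1)CF,\quad I:=(G^2-1)H^2+1.$$ Then there are integers $h,k,l,w,x,y\ge b$ for which $$DFI\in\square,\quad (U^{2P}V^2-4)K^2+4\in\square,\quad pA-p^2-1\ \text{divides}\ (p^2-1)WC-p(W^2-1),$$ $$bw=p^B\quad\text{and}\quad 16g^2(C-KL)^2<K^2.$$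
   Context: $\square=\{m^2:m\in\mathbb{Z}\}$; $p\uparrow=\{p^n:n\in\mathbb{N}\}$. *)

theory Defs
  imports "HOL-Computational_Algebra.Primes"
begin

definition squares :: "int set" where
  "squares = {m ^ 2 | m. True}"

text \<open>The exponent may be zero, so \<open>1\<close> is a power of \<open>p\<close>.\<close>

definition powers_of :: "int \<Rightarrow> int set" where
  "powers_of p = {p ^ n | n. True}"

end

theory Submission imports Defs
begin

text \<open>
  Let $u_n(A)$ be the Lucas sequence with $u_0 = 0$, $u_1 = 1$, $u_{n+2} = A u_{n+1} - u_n$.
  It satisfies the Pell equation $(A^2-4)u_n^2+4 = (2u_{n+1}-Au_n)^2$ and the congruence
  $u_n(A) \equiv n$ modulo $A-2$. Take $W = bw = p^B$, $C = u_B(A)$,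
  $K = u_{QX+1}(U^PV)$ and $H = u_B(2G)$, and let $4E$ be a term $u_m(A)$ divisible by $4C^2D$.
  Then $D$, $F$ and $I$ are separately squares.
  For the last inequality, $C/K$ is close to $(V+1)^{PX}/V^{QX}$. The integral part $L$
  of this quotient is congruent to $\binom{PX}{QX}$ modulo $V$, hence divisible by $Y$.
  There is no circularity, since $V$ does not depend on $L$.
\<close>

fun lucas :: "int \<Rightarrow> nat \<Rightarrow> int" where
  "lucas A 0 = 0"
| "lucas A (Suc 0) = 1"
| "lucas A (Suc (Suc n)) = A * lucas A (Suc n) - lucas A n"

section \<open>Lucas sequences\<close>

text \<open>The form \<open>x^2 - A*x*y + y^2\<close> is invariant under
  \<open>(x, y) -> (A*x - y, x)\<close>, so it keeps its value at the pair
  \<open>(1, 0)\<close>.\<close>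

lemma lucas_norm:
  "(lucas A (Suc n))^2 - A * lucas A (Suc n) * lucas A n + (lucas A n)^2 = 1"
proof (induction n)
  case (Suc n)
  then show ?case by (simp add: algebra_simps power2_eq_square)
qed simp

text \<open>Four times the norm identity after completing the square. It is the source of the
  squares \<open>D\<close>, \<open>F\<close> and \<open>(M^2 - 4) * K^2 + 4\<close>.\<close>

lemma lucas_pell:
  "(A^2 - 4) * (lucas A n)^2 + 4 = (2 * lucas A (Suc n) - A * lucas A n)^2"
proof -
  have "(2 * lucas A (Suc n) - A * lucas A n)^2 =
      4 * ((lucas A (Suc n))^2 - A * lucas A (Suc n) * lucas A n + (lucas A n)^2)
      + (A^2 - 4) * (lucas A n)^2"
    by (simp add: algebra_simps power2_eq_square)
  then show ?thesis by (simp only: lucas_norm)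
qed

section \<open>Growth of the sequence\<close>

lemma lucas_incr:
  assumes "A \<ge> 2"
  shows "lucas A n \<ge> 0 \<and> lucas A (Suc n) \<ge> lucas A n + 1"
proof (induction n)
  case (Suc n)
  have "A * lucas A (Suc n) \<ge> 2 * lucas A (Suc n)"
    using Suc assms by (intro mult_right_mono) auto
  then show ?case using Suc unfolding lucas.simps by linarith
qed simp

lemma lucas_nonneg: "A \<ge> 2 \<Longrightarrow> lucas A n \<ge> 0"
  using lucas_incr by blast

lemma lucas_Suc_ge_1: "A \<ge> 2 \<Longrightarrow> lucas A (Suc n) \<ge> 1"
  using lucas_incr[of A n] by linarith

lemma lucas_Suc_ge_linear:
  assumes "A \<ge> 2"
  shows "lucas A (Suc n) \<ge> 1 + int n * (A - 1)"
proof (induction n)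
  case (Suc n)
  have step: "lucas A (Suc (Suc n)) \<ge> lucas A (Suc n) + (A - 1)"
  proof -
    have "(A - 2) * lucas A (Suc n) \<ge> (A - 2) * 1"
      using lucas_Suc_ge_1[OF assms, of n] assms by (intro mult_left_mono) auto
    then show ?thesis using lucas_incr[OF assms, of n] by (simp add: algebra_simps)
  qed
  then show ?case using Suc by (simp add: algebra_simps)
qed simp

lemma lucas_ge_self:
  assumes "A \<ge> 2"
  shows "lucas A n \<ge> int n"
proof (cases n)
  case (Suc m)
  have "int m * (A - 1) \<ge> int m * 1" using assms by (intro mult_left_mono) auto
  then show ?thesis using lucas_Suc_ge_linear[OF assms, of m] Suc by simp
qed simp

lemma lucas_le_power:
  assumes "A \<ge> 2"
  shows "lucas A (Suc n) \<le> A ^ n"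
proof (induction n)
  case (Suc n)
  have "A * lucas A (Suc n) \<le> A * A ^ n" using Suc assms by (intro mult_left_mono) auto
  then show ?case using lucas_nonneg[OF assms, of n] by simp
qed simp

text \<open>With \<open>lucas_le_power\<close> this traps the term of index \<open>n + 1\<close>
  between \<open>(A - 1)^n\<close> and \<open>A^n\<close>, which controls the quotient
  \<open>C/K\<close> later.\<close>

lemma lucas_ge_power:
  assumes "A \<ge> 2"
  shows "lucas A (Suc n) \<ge> (A - 1) ^ n"
proof (induction n)
  case (Suc n)
  have "(A - 1) * lucas A (Suc n) \<ge> (A - 1) * (A - 1) ^ n"
    using Suc assms by (intro mult_left_mono) auto
  then show ?case using lucas_incr[OF assms, of n] by (simp add: algebra_simps)
qed simp

section \<open>Congruences and divisibility\<close>

lemma lucas_cong_param: "M dvd A - A' \<Longrightarrow> M dvd lucas A n - lucas A' n"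
proof (induction n rule: induct_nat_012)
  case (ge2 n)
  have "lucas A (Suc (Suc n)) - lucas A' (Suc (Suc n)) =
      (A - A') * lucas A (Suc n) + A' * (lucas A (Suc n) - lucas A' (Suc n))
      - (lucas A n - lucas A' n)"
    by (simp add: algebra_simps)
  then show ?case using ge2 by (metis dvd_add dvd_diff dvd_mult dvd_mult2)
qed auto

lemma lucas_2: "lucas 2 n = int n"
  by (induction n rule: induct_nat_012) auto

text \<open>Modulo \<open>A - 2\<close> the parameter becomes 2, where the characteristic polynomial
  has the double root 1 and the sequence is linear.\<close>

lemma lucas_cong_index: "A - 2 dvd lucas A n - int n"
  using lucas_cong_param[of "A - 2" A 2 n] by (simp add: lucas_2)

text \<open>Supplies the witnesses \<open>h\<close> and \<open>k\<close>; their size comes from the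
  linear lower bound on the sequence.\<close>

lemma lucas_eq_index_add:
  assumes "A > 2" "n \<ge> 1"
  obtains h where "lucas A n = int n + (A - 2) * h" "h \<ge> int n - 1"
proof -
  obtain h where h: "lucas A n - int n = (A - 2) * h"
    using lucas_cong_index by blast
  obtain m where m: "n = Suc m" using assms by (cases n) auto
  have "(A - 2) * h \<ge> (A - 2) * int m"
    using lucas_Suc_ge_linear[of A m] assms(1) h m by (simp add: algebra_simps)
  then have "h \<ge> int m" using assms(1) by simp
  then show ?thesis using that[of h] h m by simp
qed

text \<open>At $A = p + 1/p$ the sequence is $(p^n - p^{-n})/(p - p^{-1})$.\<close>

lemma lucas_cong_power:
  "p * A - p^2 - 1 dvd (p^2 - 1) * p^n * lucas A n - p * ((p^n)^2 - 1)"
proof (induction n rule: induct_nat_012)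
  case (ge2 n)
  let ?f = "\<lambda>n. (p^2 - 1) * p^n * lucas A n - p * ((p^n)^2 - 1)"
  \<comment> \<open>Modulo \<open>p*A - p^2 - 1\<close> both parts of \<open>?f\<close> obey the
    recurrence with characteristic roots 1 and \<open>p^2\<close>.\<close>
  have "?f (Suc (Suc n)) = (p * A - p^2 - 1) * ((p^2 - 1) * p^Suc n * lucas A (Suc n))
      + (p^2 + 1) * ?f (Suc n) - p^2 * ?f n"
    by (simp add: algebra_simps power2_eq_square)
  then show ?case using ge2 by (metis dvd_add dvd_diff dvd_mult dvd_triv_left)
qed (auto simp: algebra_simps power2_eq_square)

text \<open>The recurrence also runs backwards, so a repeated pair of consecutive residues can be
  moved down to index 0, where the term is 0.\<close>

lemma lucas_cong_shift_back:
  assumes "N dvd lucas A (i + d) - lucas A i" "N dvd lucas A (Suc i + d) - lucas A (Suc i)"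
  shows "N dvd lucas A d"
  using assms
proof (induction i)
  case (Suc i)
  have "lucas A (i + d) - lucas A i =
      A * (lucas A (Suc i + d) - lucas A (Suc i)) - (lucas A (Suc (Suc i) + d) - lucas A (Suc (Suc i)))"
    by (simp add: algebra_simps)
  then have "N dvd lucas A (i + d) - lucas A i"
    using Suc.prems by (metis dvd_diff dvd_mult)
  then show ?case using Suc by simp
qed simp

text \<open>Pigeonhole on pairs of consecutive residues modulo \<open>N\<close> gives a repetition,
  hence a multiple of \<open>N\<close> at a positive index.\<close>

lemma lucas_dvd_exists:
  assumes "N > 0"
  obtains m where "m > 0" "N dvd lucas A m"
proof -
  let ?f = "\<lambda>i. (lucas A i mod N, lucas A (Suc i) mod N)"
  have "range ?f \<subseteq> {0..<N} \<times> {0..<N}" using assms by auto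
  then have "finite (range ?f)" by (rule finite_subset) simp
  then have "\<not> inj ?f" using finite_imageD infinite_UNIV_nat by blast
  then obtain i j where ij: "?f i = ?f j" "i < j"
    unfolding inj_on_def by (metis linorder_neqE_nat)
  define d where "d = j - i"
  have j: "j = i + d" "d > 0" using ij d_def by auto
  have "N dvd lucas A (i + d) - lucas A i" "N dvd lucas A (Suc i + d) - lucas A (Suc i)"
    using ij(1)[symmetric] j by (auto simp: mod_eq_dvd_iff)
  then have "N dvd lucas A d" by (rule lucas_cong_shift_back)
  then show ?thesis using that j by blast
qed

section \<open>The square condition on $DFI$\<close>

lemma squares_mult: "a \<in> squares \<Longrightarrow> c \<in> squares \<Longrightarrow> a * c \<in> squares"
  unfolding squares_def by (auto simp: power_mult_distrib[symmetric])

text \<open>\<open>x\<close> is chosen to make \<open>4 * E\<close> a Lucas term; \<open>y\<close>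
  then exists by congruences for \<open>H\<close> modulo \<open>F\<close> and modulo
  \<open>2 * C\<close>.\<close>

lemma exists_DFI_square:
  fixes A b C :: int and n :: nat
  assumes "A > 2" "n \<ge> 3" "1 \<le> b" "b \<le> int n" and C: "C = lucas A n"
  defines "B \<equiv> int n"
  shows "\<exists>x y. x \<ge> b \<and> y \<ge> b \<and>
    (let D = (A ^ 2 - 4) * C ^ 2 + 4;
         E = C ^ 2 * D * x;
         F = 4 * (A ^ 2 - 4) * E ^ 2 + 1;
         G = 1 + C * D * F - 2 * (A + 2) * (A - 2) ^ 2 * E ^ 2;
         H = C + B * F + (2 * y - 1) * C * F;
         I = (G ^ 2 - 1) * H ^ 2 + 1
     in D * F * I \<in> squares)"
proof -
  have CB: "C \<ge> B" using lucas_ge_self[of A n] assms by simp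
  have B3: "B \<ge> 3" using assms by simp
  have C3: "C \<ge> 3" using CB B3 by simp
  have A4: "A^2 - 4 \<ge> A - 2" "A^2 - 4 \<ge> 5"
  proof -
    have "(A - 2) * (A + 2) \<ge> (A - 2) * 1" using assms(1) by (intro mult_left_mono) auto
    then show "A^2 - 4 \<ge> A - 2" by (simp add: algebra_simps power2_eq_square)
    have "A * A \<ge> 3 * 3" using assms(1) by (intro mult_mono) auto
    then show "A^2 - 4 \<ge> 5" by (simp add: power2_eq_square)
  qed
  define D where "D = (A ^ 2 - 4) * C ^ 2 + 4"
  have C2: "C^2 \<ge> C" "C^2 \<ge> 1" using C3 self_le_power[of C 2] by auto
  have DA: "D \<ge> A - 2"
  proof -
    have "(A^2 - 4) * C^2 \<ge> (A - 2) * 1" using A4 C2 assms(1) by (intro mult_mono) auto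
    then show ?thesis using D_def by simp
  qed
  have DC: "D \<ge> 2 * C + 2"
  proof -
    have "(A^2 - 4) * C^2 \<ge> 5 * C" using A4 C2 C3 by (intro mult_mono) auto
    then show ?thesis using D_def C3 by simp
  qed
  have Dsq: "D \<in> squares" unfolding D_def C lucas_pell squares_def by blast
  \<comment> \<open>The factor \<open>4 * C^2 * D\<close> gives \<open>4 * E\<close> the required
    shape; the factor \<open>b\<close> passes into \<open>x\<close> and forces
    \<open>x >= b\<close>.\<close>
  define N where "N = 4 * C^2 * D * b"
  have Npos: "N > 0" unfolding N_def using C3 DC assms(3) by simp
  obtain m where m: "m > 0" "N dvd lucas A m" using lucas_dvd_exists[OF Npos] by blast
  then obtain t where t: "lucas A m = N * t" by blast
  have "lucas A m > 0" using lucas_ge_self[of A m] assms(1) m by linarith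
  then have tpos: "t > 0" using t Npos by (simp add: zero_less_mult_iff)
  define x where "x = b * t"
  have xb: "x \<ge> b" using mult_left_mono[of 1 t b] tpos assms(3) unfolding x_def by simp
  define E where "E = C ^ 2 * D * x"
  have u4E: "lucas A m = 4 * E" unfolding t N_def E_def x_def by (simp add: algebra_simps)
  define F where "F = 4 * (A ^ 2 - 4) * E ^ 2 + 1"
  have "4 * F = 4 * (lucas A (Suc m) - 2 * A * E)^2"
    using lucas_pell[of A m] unfolding u4E F_def by (simp add: algebra_simps power2_eq_square)
  then have Fsq: "F \<in> squares" unfolding squares_def by auto
  define e where "e = (A^2 - 4) * E^2"
  have e: "e \<ge> 0" "F = 4 * e + 1" unfolding e_def F_def using A4 by auto
  define G where "G = 1 + C * D * F - 2 * (A + 2) * (A - 2) ^ 2 * E ^ 2"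
  have Ge: "G = 1 + C * D * F - 2 * (A - 2) * e"
    unfolding G_def e_def by (simp add: algebra_simps power2_eq_square)
  \<comment> \<open>The negative term of \<open>2 * G\<close> stays below \<open>C * D * F\<close>,
    because \<open>A - 2 <= C * D\<close> and \<open>4 * e < F\<close>.\<close>
  have Glarge: "2 * G - 1 \<ge> C * D * F"
  proof -
    have "C * D \<ge> 1 * D" using C3 DC by (intro mult_right_mono) auto
    then have "C * D * e \<ge> (A - 2) * e" using DA e by (intro mult_right_mono) auto
    moreover have "C * D > 0" using C3 DC by simp
    ultimately show ?thesis unfolding Ge e(2) by (simp add: algebra_simps)
  qed
  define H where "H = lucas (2 * G) n"
  have "C * D * F \<ge> 1" using C3 DC e by (simp add: int_one_le_iff_zero_less)
  then have G2: "2 * G \<ge> 2" using Glarge by linarith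
  \<comment> \<open>The hypothesis \<open>n >= 3\<close> makes the exponent \<open>n - 1\<close> at
    least 2.\<close>
  have Hlarge: "H \<ge> (C * D * F)^2"
  proof -
    have "H \<ge> (2 * G - 1)^(n - 1)"
      unfolding H_def using lucas_ge_power[OF G2, of "n - 1"] assms(2) by simp
    moreover have "(2 * G - 1)^(n - 1) \<ge> (2 * G - 1)^2"
      using G2 assms(2) by (intro power_increasing) auto
    moreover have "(2 * G - 1)^2 \<ge> (C * D * F)^2"
      using Glarge \<open>C * D * F \<ge> 1\<close> by (intro power_mono) auto
    ultimately show ?thesis by linarith
  qed
  have F1: "2 * C dvd F - 1"
  proof -
    have "F - 1 = 2 * C * (2 * (A^2 - 4) * (C * D * x) * E)"
      unfolding F_def E_def by (simp add: algebra_simps power2_eq_square)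
    then show ?thesis by simp
  qed
  \<comment> \<open>\<open>G\<close> is designed so that \<open>2 * G\<close> is congruent to
    \<open>A\<close> modulo \<open>F\<close> and to 2 modulo \<open>2 * C\<close>. Thus
    \<open>H\<close> is congruent to \<open>C\<close> and to \<open>B\<close> respectively.\<close>
  have dF: "F dvd H - C"
  proof -
    have "2 * G - A = F * (2 * C * D - (A - 2))"
      unfolding Ge e(2) e_def F_def by (simp add: algebra_simps power2_eq_square)
    then have "F dvd 2 * G - A" by simp
    then show ?thesis unfolding H_def C by (rule lucas_cong_param)
  qed
  have d2C: "2 * C dvd H - B"
  proof -
    have "2 * G - 2 = 2 * C * (D * F - 2 * (A + 2) * (A - 2)^2 * (C * D * x) * E)"
      unfolding G_def E_def by (simp add: algebra_simps power2_eq_square)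
    then have "2 * C dvd 2 * G - 2" by simp
    then show ?thesis unfolding H_def B_def using lucas_cong_index dvd_trans by blast
  qed
  have "coprime (2 * C) F"
  proof (rule coprimeI)
    fix c assume "c dvd 2 * C" "c dvd F"
    then have "c dvd F - (F - 1)" using F1 dvd_trans dvd_diff by blast
    then show "is_unit c" by simp
  qed
  \<comment> \<open>The required formula for \<open>H\<close> says that this expression equals
    \<open>2 * C * F * y\<close>; divisibility is checked for the coprime factors \<open>F\<close>
    and \<open>2 * C\<close>.\<close>
  moreover have "F dvd H - C - B * F + C * F"
  proof -
    have "H - C - B * F + C * F = (H - C) + F * (C - B)" by (simp add: algebra_simps)
    then show ?thesis using dF by simp
  qed
  moreover have "2 * C dvd H - C - B * F + C * F"
  proof -
    have "H - C - B * F + C * F = (H - B) + (F - 1) * (C - B)" by (simp add: algebra_simps)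
    then show ?thesis using d2C F1 by (metis dvd_add dvd_mult2)
  qed
  ultimately have "2 * C * F dvd H - C - B * F + C * F" by (simp add: divides_mult)
  then obtain y where y: "H - C - B * F + C * F = 2 * C * F * y" by blast
  have CF: "C * F \<ge> C" "C * F > 0" "F \<ge> 1"
    using e C3 mult_left_mono[of 1 F C] by auto
  \<comment> \<open>\<open>H\<close> is at least \<open>(C * D * F)^2\<close> and \<open>D^2\<close>
    exceeds \<open>2 * C + 2\<close>, so even \<open>y >= C\<close> holds.\<close>
  have yb: "y \<ge> b"
  proof -
    have "D * D \<ge> D * 1" using DC C3 by (intro mult_left_mono) auto
    then have "D * D \<ge> 2 * C + 2" using DC by linarith
    moreover have "C * F \<ge> 1" using CF(2) by linarith
    then have "(C * F) * (D * D) \<ge> 1 * (D * D)" by (intro mult_right_mono) auto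
    ultimately have "(C * F) * (D * D) \<ge> 2 * C + 2" by linarith
    then have "(C * F) * ((C * F) * (D * D)) \<ge> (C * F) * (2 * C + 2)"
      using CF by (intro mult_left_mono) auto
    then have "H \<ge> (C * F) * (2 * C + 2)"
      using Hlarge by (simp add: algebra_simps power2_eq_square)
    moreover have "B * F \<le> C * F" using CB CF by (intro mult_right_mono) auto
    moreover have "(C * F) * (2 * C + 2) = 2 * C * F * C + 2 * (C * F)"
      by (simp add: algebra_simps)
    ultimately have "2 * C * F * y \<ge> 2 * C * F * C"
      using y CF(1,2) by linarith
    moreover have "2 * C * F > 0" using CF(2) by simp
    ultimately have "y \<ge> C" by (rule mult_left_le_imp_le)
    then show ?thesis using CB assms(4) B_def by simp
  qed
  have H: "H = C + B * F + (2 * y - 1) * C * F" using y by (simp add: algebra_simps)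
  have "(G ^ 2 - 1) * H ^ 2 + 1 = (lucas (2 * G) (Suc n) - G * H)^2"
    using lucas_norm[of "2 * G" n] unfolding H_def
    by (simp add: algebra_simps power2_eq_square)
  then have Isq: "(G ^ 2 - 1) * H ^ 2 + 1 \<in> squares" unfolding squares_def by blast
  have "D * F * ((G ^ 2 - 1) * H ^ 2 + 1) \<in> squares"
    by (intro squares_mult Dsq Fsq Isq)
  then show ?thesis
    using xb yb unfolding Let_def H G_def F_def E_def D_def by blast
qed

section \<open>The quotient $C/K$\<close>

text \<open>Bernoulli's inequality for \<open>(1 - 1/a)^n\<close>, multiplied by
  \<open>a^(n+1)\<close>.\<close>

lemma power_pred_ge:
  fixes a :: int
  assumes "a \<ge> 1"
  shows "a * (a - 1) ^ n \<ge> (a - int n) * a ^ n"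
proof (induction n)
  case (Suc n)
  have "(a - 1) * (a * (a - 1) ^ n) \<ge> (a - 1) * ((a - int n) * a ^ n)"
    using Suc assms by (intro mult_left_mono) auto
  moreover have "int n * a ^ n \<ge> 0" using assms by simp
  ultimately show ?case by (simp add: algebra_simps)
qed simp

text \<open>The expansion is cut at \<open>V^q\<close>. The constant term of \<open>L\<close> is
  \<open>n choose q\<close> and its other terms are multiples of \<open>V\<close>, so
  \<open>Y\<close> divides \<open>L\<close>; the term \<open>i = n\<close> gives
  \<open>L >= V\<close>. In \<open>R\<close> all powers are below \<open>V^q\<close> and the
  coefficients sum to at most \<open>2^n\<close>.\<close>

lemma binomial_split:
  fixes V :: int
  assumes "V \<ge> 1" "1 \<le> q" "q < n" "Y dvd V" "Y dvd int (n choose q)"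
  obtains L R where "(V + 1) ^ n = L * V ^ q + R" "0 \<le> R" "V * R \<le> 2 ^ n * V ^ q"
    "Y dvd L" "L \<ge> V"
proof -
  let ?t = "\<lambda>i. int (n choose i) * V ^ i"
  define R where "R = (\<Sum>i<q. ?t i)"
  define L where "L = (\<Sum>i=q..n. int (n choose i) * V ^ (i - q))"
  have "(V + 1) ^ n = (\<Sum>i\<le>n. ?t i)" by (simp add: binomial_ring)
  also have "{..n} = {..<q} \<union> {q..n}" using assms by auto
  also have "(\<Sum>i\<in>{..<q} \<union> {q..n}. ?t i) = R + (\<Sum>i=q..n. ?t i)"
    unfolding R_def by (intro sum.union_disjoint) auto
  also have "(\<Sum>i=q..n. ?t i) = L * V ^ q"
    unfolding L_def sum_distrib_right
    by (intro sum.cong) (auto simp: power_add[symmetric] mult.assoc)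
  finally have 1: "(V + 1) ^ n = L * V ^ q + R" by simp
  have 2: "0 \<le> R" unfolding R_def using assms by (intro sum_nonneg) auto
  have 3: "V * R \<le> 2 ^ n * V ^ q"
  proof -
    have "V * R = (\<Sum>i<q. int (n choose i) * V ^ Suc i)"
      unfolding R_def by (simp add: sum_distrib_left algebra_simps)
    also have "\<dots> \<le> (\<Sum>i<q. int (n choose i) * V ^ q)"
      using assms by (intro sum_mono mult_left_mono power_increasing) auto
    also have "\<dots> \<le> (\<Sum>i\<le>n. int (n choose i) * V ^ q)"
      using assms by (intro sum_mono2) auto
    also have "\<dots> = int (\<Sum>i\<le>n. n choose i) * V ^ q"
      by (simp add: sum_distrib_right)
    also have "\<dots> = 2 ^ n * V ^ q" by (simp only: choose_row_sum) simp
    finally show ?thesis .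
  qed
  have 4: "Y dvd L" unfolding L_def
  proof (rule dvd_sum)
    fix i assume "i \<in> {q..n}"
    show "Y dvd int (n choose i) * V ^ (i - q)"
    proof (cases "i = q")
      case False
      then have "V dvd V ^ (i - q)" using \<open>i \<in> {q..n}\<close> by (simp add: dvd_power)
      then show ?thesis using assms(4) dvd_trans dvd_mult by blast
    qed (use assms in simp)
  qed
  have 5: "L \<ge> V"
  proof -
    have "V \<le> V ^ (n - q)" using assms by (intro self_le_power) auto
    also have "\<dots> = int (n choose n) * V ^ (n - q)" by simp
    also have "\<dots> \<le> L" unfolding L_def
      using assms by (intro member_le_sum[where i = n and A = "{q..n}"]) auto
    finally show ?thesis .
  qed
  show ?thesis using that 1 2 3 4 5 by blast
qed

text \<open>\<open>C/K\<close> is close to \<open>A^n / M^q = L + R / V^q\<close>, the factor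
  \<open>T\<close> cancelling. The relative errors, at most \<open>n/A\<close> and
  \<open>q/M\<close>, are multiplied by about \<open>L\<close>, hence the bounds
  \<open>32 * g * L * n\<close> and \<open>32 * g * L * q\<close>.\<close>

lemma lucas_quotient_approx:
  fixes A M L g T R V :: int and n q :: nat
  assumes AT: "A ^ n = T * (V + 1) ^ n" and MT: "M ^ q = T * V ^ q"
    and LR: "(V + 1) ^ n = L * V ^ q + R" and R: "0 \<le> R" "8 * g * R \<le> V ^ q"
    and M: "M \<ge> 32 * g * L * int q" and A: "A \<ge> 32 * g * L * int n"
    and pos: "g \<ge> 1" "L \<ge> 1" "T \<ge> 1" "q \<ge> 1" "n \<ge> 1"
  shows "16 * g ^ 2 * (lucas A (Suc n) - lucas M (Suc q) * L) ^ 2 < (lucas M (Suc q)) ^ 2"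
proof -
  define Z where "Z = M ^ q"
  define K where "K = lucas M (Suc q)"
  define C where "C = lucas A (Suc n)"
  have gL: "g * L \<ge> 1" using pos by (simp add: int_one_le_iff_zero_less)
  have gq: "g * L * int q \<ge> int q" "g * L * int n \<ge> int n"
    using gL mult_right_mono[of 1 "g * L" "int q"] mult_right_mono[of 1 "g * L" "int n"] by auto
  have Mq: "M \<ge> 32 * int q" "M \<ge> 2" and An: "A \<ge> 32 * int n" "A \<ge> 2"
  proof -
    have "32 * g * L * int q = 32 * (g * L * int q)" "32 * g * L * int n = 32 * (g * L * int n)"
      by simp_all
    then show "M \<ge> 32 * int q" "M \<ge> 2" "A \<ge> 32 * int n" "A \<ge> 2"
      using M A gq pos(4,5) by linarith+
  qed
  have Zpos: "Z > 0" unfolding Z_def using Mq by simp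
  have KZ: "K \<le> Z" unfolding K_def Z_def using lucas_le_power Mq by blast
  have MK: "M * K \<ge> (M - int q) * Z"
  proof -
    have "M * K \<ge> M * (M - 1) ^ q"
      unfolding K_def using lucas_ge_power Mq by (intro mult_left_mono) auto
    then show ?thesis using power_pred_ge[of M q] Mq unfolding Z_def by linarith
  qed
  have AC: "A * C \<ge> (A - int n) * A ^ n"
  proof -
    have "A * C \<ge> A * (A - 1) ^ n"
      unfolding C_def using lucas_ge_power An by (intro mult_left_mono) auto
    then show ?thesis using power_pred_ge[of A n] An by linarith
  qed
  have AnZ: "A ^ n = L * Z + T * R" unfolding AT LR Z_def MT by (simp add: algebra_simps)
  have TR: "T * R \<ge> 0" using R pos by simp
  have TR8: "8 * g * (T * R) \<le> Z"
    using mult_left_mono[OF R(2), of T] pos unfolding Z_def MT by (simp add: algebra_simps)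
  have qZ: "32 * (int q * Z) \<le> M * Z" using Mq Zpos by simp
  have gqZ: "32 * (g * L * int q * Z) \<le> M * Z" using M Zpos by (simp add: mult.assoc)
  \<comment> \<open>This turns error bounds in terms of \<open>Z\<close> into bounds in terms of
    \<open>K\<close>.\<close>
  have K2: "2 * K > Z"
  proof -
    have "M * (2 * K) \<ge> 2 * (M * Z) - 2 * (int q * Z)" using MK by (simp add: algebra_simps)
    moreover have "M * Z > 0" using Mq Zpos by simp
    ultimately have "M * (2 * K) > M * Z" using qZ by linarith
    then show ?thesis using Mq by simp
  qed
  \<comment> \<open>After scaling by \<open>8 * g * M\<close>, the error of \<open>K\<close> costs
    at most \<open>M * Z / 4\<close> and the remainder \<open>T * R\<close> at most
    \<open>M * Z\<close>; the sum is below \<open>2 * (M - q) * Z <= 2 * M * K\<close>.\<close>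
  have up: "4 * g * (C - K * L) < K"
  proof -
    have "C \<le> L * Z + T * R" using lucas_le_power[OF An(2), of n] AnZ unfolding C_def by simp
    then have "8 * g * (C - K * L) \<le> 8 * g * (L * Z + T * R - K * L)"
      using pos by (intro mult_left_mono) auto
    also have "\<dots> \<le> 8 * (g * L) * (Z - K) + Z" using TR8 by (simp add: algebra_simps)
    finally have "M * (8 * g * (C - K * L)) \<le> M * (8 * (g * L) * (Z - K) + Z)"
      using Mq by (intro mult_left_mono) auto
    also have "\<dots> = 8 * (g * L) * (M * Z - M * K) + M * Z" by (simp add: algebra_simps)
    also have "\<dots> \<le> 8 * (g * L) * (int q * Z) + M * Z"
      using MK gL by (intro add_right_mono mult_left_mono) (auto simp: algebra_simps)
    also have "\<dots> = 8 * (g * L * int q * Z) + M * Z" by (simp add: algebra_simps)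
    also have "\<dots> < 2 * (M * Z) - 2 * (int q * Z)"
    proof -
      have "M * Z > 0" using Mq Zpos by simp
      then show ?thesis using qZ gqZ by linarith
    qed
    also have "\<dots> \<le> M * (2 * K)" using MK by (simp add: algebra_simps)
    finally have "8 * g * (C - K * L) < 2 * K" using Mq by simp
    then show ?thesis by simp
  qed
  \<comment> \<open>Here \<open>T * R\<close> helps and is dropped; only the relative error
    \<open>n/A\<close> of \<open>C\<close> counts.\<close>
  have low: "4 * g * (K * L - C) < K"
  proof -
    have "(A - int n) * A ^ n \<ge> (A - int n) * (L * Z)"
      using An TR AnZ by (intro mult_left_mono) auto
    then have *: "A * (L * Z - C) \<le> int n * (L * Z)" using AC by (simp add: algebra_simps)
    have "K * L \<le> L * Z" using KZ pos by simp
    then have "A * (32 * g * (K * L - C)) \<le> A * (32 * g * (L * Z - C))"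
      using An pos by (intro mult_left_mono) auto
    also have "\<dots> \<le> 32 * g * (int n * (L * Z))"
      using mult_left_mono[OF *, of "32 * g"] pos by (simp add: algebra_simps)
    also have "\<dots> \<le> A * Z"
      using mult_right_mono[OF A, of Z] Zpos by (simp add: algebra_simps)
    finally have "32 * g * (K * L - C) \<le> Z" using An by simp
    then show ?thesis using K2 Zpos by linarith
  qed
  have "\<bar>4 * g * (C - K * L)\<bar> < K" using up low by (simp add: abs_less_iff algebra_simps)
  then have "\<bar>4 * g * (C - K * L)\<bar> ^ 2 < K ^ 2" by (intro power_strict_mono) auto
  then show ?thesis unfolding C_def K_def by (simp add: power_mult_distrib)
qed

section \<open>Choice of the witnesses and verification of the conditions\<close>

theorem theorem4p1:
  fixes p b g P Q X Y :: int
  assumes "prime p"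
    and "b \<in> powers_of p"
    and "g > 0"
    and "P > Q" and "Q > 0"
    and "X \<ge> b" and "Y \<ge> b"
    and "Y dvd int (nat (P * X) choose nat (Q * X))"
  shows "\<exists>h k l w x y :: int.
    h \<ge> b \<and> k \<ge> b \<and> l \<ge> b \<and> w \<ge> b \<and> x \<ge> b \<and> y \<ge> b \<and>
    (let L = l * Y;
         U = P * L * X;
         V = 4 * g * w * Y;
         W = b * w;
         K = Q * X + 1 + k * (U ^ nat P * V - 2);
         A = U ^ nat Q * (V + 1);
         B = P * X + 1;
         C = B + (A - 2) * h;
         D = (A ^ 2 - 4) * C ^ 2 + 4;
         E = C ^ 2 * D * x;
         F = 4 * (A ^ 2 - 4) * E ^ 2 + 1;
         G = 1 + C * D * F - 2 * (A + 2) * (A - 2) ^ 2 * E ^ 2;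
         H = C + B * F + (2 * y - 1) * C * F;
         I = (G ^ 2 - 1) * H ^ 2 + 1
     in D * F * I \<in> squares
      \<and> (U ^ nat (2 * P) * V ^ 2 - 4) * K ^ 2 + 4 \<in> squares
      \<and> p * A - p ^ 2 - 1 dvd (p ^ 2 - 1) * W * C - p * (W ^ 2 - 1)
      \<and> b * w = p ^ nat B
      \<and> 16 * g ^ 2 * (C - K * L) ^ 2 < K ^ 2)"
proof -
  have p2: "p \<ge> 2" using assms(1) by (rule prime_ge_2_int)
  obtain r where r: "b = p ^ r" using assms(2) unfolding powers_of_def by blast
  have b1: "b \<ge> 1" using p2 r by simp
  have X1: "X \<ge> 1" and Y1: "Y \<ge> 1" using assms b1 by auto
  have P2: "P \<ge> 2" using assms by simp
  define n where "n = nat (P * X)"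
  define q where "q = nat (Q * X)"
  have nX: "int n = P * X" and qX: "int q = Q * X"
    unfolding n_def q_def using P2 X1 assms(5) by auto
  have n2X: "int n \<ge> 2 * X" unfolding nX using P2 X1 by simp
  have qXge: "int q \<ge> X" unfolding qX using mult_right_mono[of 1 Q X] assms(5) X1 by simp
  have "Q * X < P * X" using assms(4) X1 by simp
  then have qn: "q < n" using nX qX by linarith
  have q1: "q \<ge> 1" and n2: "n \<ge> 2" using qXge n2X X1 by auto
  \<comment> \<open>From \<open>r < p^r = b <= X\<close> follows \<open>2 * r <= n + 1\<close>, so
    the cofactor \<open>w\<close> of \<open>b\<close> in \<open>p^(n+1)\<close> is at least
    \<open>b\<close>.\<close>
  have "int r < b"
  proof -
    have "r < 2 ^ r" by (rule less_exp)
    then have "int r < 2 ^ r" by (metis of_nat_less_iff of_nat_power of_nat_numeral)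
    also have "(2::int) ^ r \<le> b" unfolding r using p2 by (intro power_mono) auto
    finally show ?thesis .
  qed
  then have rn: "2 * r \<le> Suc n" using assms(6) n2X by linarith
  define w where "w = p ^ (Suc n - r)"
  have bw: "b * w = p ^ Suc n"
    unfolding r w_def using rn by (simp add: power_add[symmetric])
  have wb: "w \<ge> b" unfolding r w_def using p2 rn by (intro power_increasing) auto
  define V where "V = 4 * g * w * Y"
  \<comment> \<open>Since \<open>Y >= b\<close>, \<open>w * Y\<close> is at least
    \<open>p^(n+1)\<close>. The factor \<open>2^n\<close> absorbs the binomial coefficients in
    \<open>R\<close>.\<close>
  have V_large: "V \<ge> 8 * g * 2 ^ n"
  proof -
    have "(2::int) ^ Suc n \<le> p ^ Suc n" using p2 by (intro power_mono) auto
    also have "\<dots> \<le> w * Y" unfolding bw[symmetric] using assms(7) wb b1 by simp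
    finally have "4 * g * 2 ^ Suc n \<le> 4 * g * (w * Y)"
      using assms(3) by (intro mult_left_mono) auto
    then show ?thesis unfolding V_def by (simp add: algebra_simps)
  qed
  have "(2::int) ^ 2 \<le> 2 ^ n" using n2 by (intro power_increasing) auto
  then have "8 * g * 4 \<le> 8 * g * 2 ^ n" using assms(3) by (intro mult_left_mono) auto
  then have V32: "V \<ge> 32 * g" using V_large by linarith
  have V1: "V \<ge> 1" using V32 assms(3) by linarith
  have "Y dvd V" unfolding V_def by simp
  then obtain L R where LR: "(V + 1) ^ n = L * V ^ q + R" "0 \<le> R" "V * R \<le> 2 ^ n * V ^ q"
      and L: "Y dvd L" "L \<ge> V"
    using binomial_split[of V q n Y] V1 q1 qn assms(8) unfolding n_def[symmetric] q_def[symmetric]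
    by blast
  have L1: "L \<ge> 1" using L V1 by linarith
  obtain l where l: "L = l * Y" using L(1) by (metis dvdE mult.commute)
  have lb: "l \<ge> b"
  proof -
    have "4 * g * w * Y \<le> l * Y" using L(2) l V_def by simp
    then have "4 * g * w \<le> l" using Y1 by simp
    moreover have "1 * w \<le> 4 * g * w" using assms(3) wb b1 by (intro mult_right_mono) auto
    ultimately show ?thesis using wb by linarith
  qed
  have R8: "8 * g * R \<le> V ^ q"
  proof -
    have "2 ^ n * (8 * g * R) = (8 * g * 2 ^ n) * R" by simp
    also have "\<dots> \<le> V * R" using V_large LR(2) by (intro mult_right_mono) auto
    also have "\<dots> \<le> 2 ^ n * V ^ q" by (rule LR(3))
    finally show ?thesis by simp
  qed
  define U where "U = P * L * X"
  have Un: "U = int n * L" unfolding U_def nX by (simp add: algebra_simps)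
  have U1: "U \<ge> 1" unfolding Un using n2 L1 by (simp add: int_one_le_iff_zero_less)
  \<comment> \<open>One factor \<open>U = n * L\<close> and \<open>V >= 32 * g\<close> already give
    the bound, for both \<open>A\<close> and \<open>M\<close>.\<close>
  have Upow: "U ^ i * c \<ge> 32 * g * L * int n" if "i \<ge> 1" "c \<ge> V" for i c
  proof -
    have "U ^ i \<ge> U" using U1 that by (intro self_le_power) auto
    then have "U ^ i * c \<ge> U * (32 * g)" using that V32 U1 assms(3) by (intro mult_mono) auto
    then show ?thesis unfolding Un by (simp add: algebra_simps)
  qed
  define A where "A = U ^ nat Q * (V + 1)"
  define M where "M = U ^ nat P * V"
  have A_large: "A \<ge> 32 * g * L * int n" unfolding A_def using assms(5) by (intro Upow) auto
  have M_large: "M \<ge> 32 * g * L * int n" unfolding M_def using P2 by (intro Upow) auto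
  have gLn: "g * L * int n \<ge> 1" using assms(3) L1 n2 by (simp add: int_one_le_iff_zero_less)
  then have A2: "A > 2" and M2: "M > 2" using A_large M_large by (simp_all add: mult.assoc)
  have "g * L * int q \<le> g * L * int n" using qn assms(3) L1 by (intro mult_left_mono) auto
  then have M_large': "M \<ge> 32 * g * L * int q" using M_large by (simp add: mult.assoc)
  \<comment> \<open>The exponents of \<open>U\<close> in \<open>A^n\<close> and in
    \<open>M^q\<close> agree, both being \<open>P * Q * X\<close>.\<close>
  define T where "T = U ^ (nat Q * n)"
  have "nat P * q = nat Q * n"
  proof -
    have "int (nat P * q) = int (nat Q * n)" using P2 assms(5) by (simp add: nX qX)
    then show ?thesis by linarith
  qed
  then have MT: "M ^ q = T * V ^ q"
    unfolding M_def T_def by (simp add: power_mult_distrib power_mult[symmetric])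
  have AT: "A ^ n = T * (V + 1) ^ n"
    unfolding A_def T_def by (simp add: power_mult_distrib power_mult[symmetric])
  have T1: "T \<ge> 1" unfolding T_def using U1 by simp
  define C where "C = lucas A (Suc n)"
  define K where "K = lucas M (Suc q)"
  have approx: "16 * g ^ 2 * (C - K * L) ^ 2 < K ^ 2"
    unfolding C_def K_def
    using lucas_quotient_approx[OF AT MT LR(1,2) R8 M_large' A_large] assms(3) L1 T1 q1 n2
    by simp
  obtain h where h: "C = P * X + 1 + (A - 2) * h" "h \<ge> P * X"
    using lucas_eq_index_add[of A "Suc n"] A2 unfolding C_def nX[symmetric]
    by (auto simp: algebra_simps)
  obtain k where k: "K = Q * X + 1 + k * (M - 2)" "k \<ge> Q * X"
    using lucas_eq_index_add[of M "Suc q"] M2 unfolding K_def qX[symmetric]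
    by (auto simp: algebra_simps)
  have hb: "h \<ge> b" using h(2) n2X nX X1 assms(6) by linarith
  have kb: "k \<ge> b" using k(2) qXge qX assms(6) by linarith
  have Bn: "int (Suc n) = P * X + 1" using nX by simp
  have nB: "nat (P * X + 1) = Suc n" using Bn by linarith
  have bn: "b \<le> int (Suc n)" using assms(6) n2X X1 by linarith
  \<comment> \<open>The index is \<open>Suc n\<close>, that is \<open>B = P * X + 1\<close>, and it
    is at least 3 because \<open>n >= 2\<close>.\<close>
  obtain x y where xb: "x \<ge> b" and yb: "y \<ge> b" and DFI:
    "let D = (A ^ 2 - 4) * C ^ 2 + 4;
         E = C ^ 2 * D * x;
         F = 4 * (A ^ 2 - 4) * E ^ 2 + 1;
         G = 1 + C * D * F - 2 * (A + 2) * (A - 2) ^ 2 * E ^ 2;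
         H = C + (P * X + 1) * F + (2 * y - 1) * C * F;
         I = (G ^ 2 - 1) * H ^ 2 + 1
     in D * F * I \<in> squares"
    using exists_DFI_square[OF A2 _ b1 bn C_def] n2 unfolding Bn by auto
  have "nat (2 * P) = nat P * 2" using P2 by simp
  then have "U ^ nat (2 * P) * V ^ 2 = M ^ 2"
    unfolding M_def by (simp add: power_mult power_mult_distrib)
  then have Ksq: "(U ^ nat (2 * P) * V ^ 2 - 4) * K ^ 2 + 4 \<in> squares"
    unfolding K_def squares_def using lucas_pell[of M "Suc q"] by auto
  have dvd: "p * A - p ^ 2 - 1 dvd (p ^ 2 - 1) * (b * w) * C - p * ((b * w) ^ 2 - 1)"
    unfolding bw C_def by (rule lucas_cong_power)
  have bw': "b * w = p ^ nat (P * X + 1)" unfolding nB by (rule bw)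
  note facts = DFI Ksq dvd bw' approx
  show ?thesis
    apply (rule exI[of _ h], rule exI[of _ k], rule exI[of _ l],
        rule exI[of _ w], rule exI[of _ x], rule exI[of _ y])
    apply (intro conjI hb kb lb wb xb yb)
    using facts
    unfolding Let_def l[symmetric] U_def[symmetric] V_def[symmetric] A_def[symmetric]
      M_def[symmetric] h(1)[symmetric] k(1)[symmetric]
    by blast
qed

end
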